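(* Let $f_0,\ldots,f_k\in S=\mathbb{C}[x_1^{\pm1},\ldots,x_n^{\pm1}]$ be Laurent polynomials with Newton polytopes $\mathcal{A}_0,\ldots,\mathcal{A}_k\subseteq\mathbb{R}^n$ respectively. Let $\mathcal{B}_i=\mathcal{A}_0+\ldots+\widehat{\mathcal{A}_i}+\ldots+\mathcal{A}_k$ (Minkowski sum omitting $\mathcal{A}_i$), $0\leq i\leq k$, and let $\mathcal{E}=\mathcal{A}_0+\ldots+\mathcal{A}_k$. Assume that $0\in\mathcal{A}_0$ and $f_0$ is a non-constant Laurent polynomial, that the lattice polytope $\mathcal{E}$ is full dimensional (of dimension $n$), and that $\langle f_0,f_1,\ldots,f_k\rangle=S$. Let $$M=\begin{pmatrix} M_{11} & M_{12} \\ M_{21} & M_{22} \end{pmatrix}$$ be the coefficient matrix associated to the sparse system $\{f_1,\ldots,f_k\}$ and $f_0$, with $M_{11}\in\mathbb{C}^{p\times p}$ and $M_{22}\in\mathbb{C}^{q\times(p_1+\ldots+p_k)}$, and let $F\in\mathbb{C}^{(p_1+\ldots+p_k)\times p}$ be a solution of the linear equation $M_{21}+M_{22}F=0$. Then every solution $\xi$ of the sparse system $\{f_1,\ldots,f_k\}$ determines a left eigenvector of $M_{11}+M_{12}F$. Even more, $f_0(\xi)$ is the eigenvalue of that left eigenvector.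
   Context: A sparse system is a collection $\{f_1,\ldots,f_k\}$ of Laurent polynomials with fixed finite supports in $\mathbb{Z}^n$; a solution of it is a point $\xi$ with $f_1(\xi)=\ldots=f_k(\xi)=0$. The Newton polytope $N(g)$ of a Laurent polynomial $g\in S$ is the convex hull in $\mathbb{R}^n$ of its support (its set of exponents). For a lattice polytope $\mathcal{A}\subseteq\mathbb{R}^n$ (convex hull of a finite subset of $\mathbb{Z}^n$), $S_{\mathcal{A}}=\{g\in S : N(g)\subseteq\mathcal{A}\}$, a vector space with monomial basis $\{x^m : m\in\mathcal{A}\cap\mathbb{Z}^n\}$, where $x^m=x_1^{m^{(1)}}\cdots x_n^{m^{(n)}}$ for $m=(m^{(1)},\ldots,m^{(n)})$. Coefficient matrix: since $0\in\mathcal{A}_0$, $\mathcal{B}_0\subseteq\mathcal{E}$. Let $p=\#(\mathcal{B}_0\cap\mathbb{Z}^n)$, $p_i=\#(\mathcal{B}_i\cap\mathbb{Z}^n)$ for $1\le i\le k$, and $p+q=\#(\mathcal{E}\cap\mathbb{Z}^n)$ (here $q>0$). Order the lattice points so that $\mathcal{B}_0\cap\mathbb{Z}^n=\{m_1,\ldots,m_p\}$ and $\mathcal{E}\cap\mathbb{Z}^n=\{m_1,\ldots,m_p,m_{p+1},\ldots,m_{p+q}\}$, and fix an order on each $\mathcal{B}_i\cap\mathbb{Z}^n$, $1\le i\le k$. The coefficient matrix $M\in\mathbb{C}^{(p+q)\times(p+p_1+\ldots+p_k)}$ is the matrix, in these monomial bases, of the linear map $$\Psi:S_{\mathcal{B}_0}\times\ldots\times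 S_{\mathcal{B}_k}\rightarrow S_{\mathcal{E}},\quad \Psi(g_0,\ldots,g_k)=f_0\cdot g_0+\sum_{i=1}^k f_i\cdot g_i,$$ that is, its columns are the coefficient vectors of $f_0x^{m_1},\ldots,f_0x^{m_p}$ followed by those of $f_i x^{m}$, $m\in\mathcal{B}_i\cap\mathbb{Z}^n$, $i=1,\ldots,k$. It is divided into four blocks with $M_{11}\in\mathbb{C}^{p\times p}$ and $M_{22}\in\mathbb{C}^{q\times(p_1+\ldots+p_k)}$. *)

theory Defs
  imports
    "HOL-Analysis.Analysis"
    "HOL-Library.Poly_Mapping"
    "Jordan_Normal_Form.Char_Poly"
begin

text \<open>Multiplication on \<open>\<Rightarrow>\<^sub>0\<close> is convolution, so the finitely supported functions on
  \<open>\<int>\<^sup>n\<close> form the Laurent polynomial ring, with \<open>single m 1\<close> as the monomial \<open>x\<^sup>m\<close>.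
  Both \<open>real ^ 'n\<close> and the matrices and vectors of variable size are used, so
  \<open>vec_nth\<close> is written in prefix form to avoid the ambiguous infix.\<close>

type_synonym 'n laurent = "(int ^ 'n) \<Rightarrow>\<^sub>0 complex"

definition exponent_point :: "int ^ 'n \<Rightarrow> real ^ 'n" where
  "exponent_point m = (\<chi> i. real_of_int (vec_nth m i))"

definition newton_polytope :: "'n::finite laurent \<Rightarrow> (real ^ 'n) set" where
  "newton_polytope g = convex hull (exponent_point ` Poly_Mapping.keys g)"

definition lattice_points :: "(real ^ 'n) set \<Rightarrow> (int ^ 'n) set" where
  "lattice_points P = {m. exponent_point m \<in> P}"

definition newton_sum :: "(nat \<Rightarrow> 'n::finite laurent) \<Rightarrow> nat \<Rightarrow> (real ^ 'n) set" where
  "newton_sum f k = (\<Sum>j\<in>{..k}. newton_polytope (f j))"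

definition newton_sum_omit :: "(nat \<Rightarrow> 'n::finite laurent) \<Rightarrow> nat \<Rightarrow> nat \<Rightarrow> (real ^ 'n) set" where
  "newton_sum_omit f k i = (\<Sum>j\<in>{..k} - {i}. newton_polytope (f j))"

definition is_constant :: "'n::finite laurent \<Rightarrow> bool" where
  "is_constant g \<longleftrightarrow> (\<exists>c. g = Poly_Mapping.single 0 c)"

lemma module_times: "Modules.module ((*) :: 'a::comm_ring_1 \<Rightarrow> 'a \<Rightarrow> 'a)"
  by unfold_locales (simp_all add: algebra_simps)

text \<open>An ideal is a submodule of the ring over itself.\<close>

definition ideal_generated :: "'a::comm_ring_1 set \<Rightarrow> 'a set" where
  "ideal_generated A = Modules.module.span (*) A"

definition monomial_value :: "complex ^ 'n::finite \<Rightarrow> int ^ 'n \<Rightarrow> complex" where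
  "monomial_value \<xi> m = (\<Prod>i\<in>UNIV. vec_nth \<xi> i powi vec_nth m i)"

definition laurent_eval :: "'n::finite laurent \<Rightarrow> complex ^ 'n \<Rightarrow> complex" where
  "laurent_eval g \<xi> = (\<Sum>m\<in>Poly_Mapping.keys g. Poly_Mapping.lookup g m * monomial_value \<xi> m)"

text \<open>Laurent polynomials are functions on the torus \<open>(\<complex> - {0})\<^sup>n\<close> only; the operator \<open>powi\<close>
  is total, so the domain has to be imposed explicitly.\<close>

definition is_solution :: "(nat \<Rightarrow> 'n::finite laurent) \<Rightarrow> nat \<Rightarrow> complex ^ 'n \<Rightarrow> bool" where
  "is_solution f k \<xi> \<longleftrightarrow>
     (\<forall>i. vec_nth \<xi> i \<noteq> 0) \<and> (\<forall>i\<in>{1..k}. laurent_eval (f i) \<xi> = 0)"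

definition coeff_vec :: "(int ^ 'n) list \<Rightarrow> 'n::finite laurent \<Rightarrow> complex Matrix.vec" where
  "coeff_vec es g = vec_of_list (map (Poly_Mapping.lookup g) es)"

text \<open>The lists fix the orders of the monomial bases: \<open>es\<close> enumerates the lattice points of
  \<open>newton_sum f k\<close> and \<open>bs i\<close> those of \<open>newton_sum_omit f k i\<close>, for \<open>i \<le> k\<close>.\<close>

definition coeff_matrix ::
  "(nat \<Rightarrow> 'n::finite laurent) \<Rightarrow> nat \<Rightarrow> (int ^ 'n) list \<Rightarrow> (nat \<Rightarrow> (int ^ 'n) list) \<Rightarrow> complex mat"
where
  "coeff_matrix f k es bs = mat_of_cols (length es)
     (map (coeff_vec es)
       (concat (map (\<lambda>i. map (\<lambda>m. f i * Poly_Mapping.single m 1) (bs i)) [0..<Suc k])))"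

definition left_eigenvector :: "complex mat \<Rightarrow> complex Matrix.vec \<Rightarrow> complex \<Rightarrow> bool" where
  "left_eigenvector A v a \<longleftrightarrow> eigenvector (transpose_mat A) v a"

end

theory Submission
  imports Defs
begin

text \<open>Let \<open>v = (w, u)\<close> be the row of the monomial values at \<open>\<xi>\<close> over the lattice points of
  \<open>\<E>\<close>, split after the first \<open>p\<close> entries. Multiplying \<open>v\<close> with the column of
  \<open>f\<^sub>i x\<^sup>m\<close> evaluates that Laurent polynomial at \<open>\<xi>\<close>, so \<open>v M = (f\<^sub>0(\<xi>) w, 0)\<close>.
  Multiplying from the right with the columns of \<open>I\<close> stacked on \<open>F\<close> kills the
  contribution of \<open>u\<close>, since \<open>M\<^sub>2\<^sub>1 + M\<^sub>2\<^sub>2 F = 0\<close>, and leaves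
  \<open>w (M\<^sub>1\<^sub>1 + M\<^sub>1\<^sub>2 F) = f\<^sub>0(\<xi>) w\<close>. The vector \<open>w\<close> has nonzero entries, and it is not
  empty because a nonempty \<open>\<E>\<close> forces every Newton polytope to be nonempty.\<close>

unbundle no vec_syntax

text \<open>Padding the support with zero coefficients lets evaluations be summed over a shifted
  support or over all rows of the matrix.\<close>

lemma laurent_eval_superset:
  assumes "finite A" "Poly_Mapping.keys g \<subseteq> A"
  shows "laurent_eval g \<xi> = (\<Sum>m\<in>A. Poly_Mapping.lookup g m * monomial_value \<xi> m)"
  unfolding laurent_eval_def using assms
  by (intro sum.mono_neutral_left) (auto simp: in_keys_iff)

text \<open>The torus condition matters because \<open>powi\<close> is total: at a zero coordinate,
  exponents 1 and -1 would contribute 1 to the left side but 0 to the right.\<close>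

lemma monomial_value_add:
  assumes "\<And>i. vec_nth \<xi> i \<noteq> 0"
  shows "monomial_value \<xi> (a + b) = monomial_value \<xi> a * monomial_value \<xi> b"
  using assms by (simp add: monomial_value_def power_int_add prod.distrib)

lemma monomial_value_nonzero:
  assumes "\<And>i. vec_nth \<xi> i \<noteq> 0"
  shows "monomial_value \<xi> m \<noteq> 0"
  using assms by (simp add: monomial_value_def)

text \<open>In the convolution only the exponent pair \<open>(a - m, m)\<close> can contribute,
  since the second factor is supported at \<open>m\<close>.\<close>

lemma lookup_times_monomial:
  fixes g :: "'a::ab_group_add \<Rightarrow>\<^sub>0 'b::comm_semiring_1"
  shows "Poly_Mapping.lookup (g * Poly_Mapping.single m 1) a = Poly_Mapping.lookup g (a - m)"
proof -
  have "a = b + c \<longleftrightarrow> b = a - c" for b c :: 'a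
    by (auto simp: algebra_simps)
  then have "Poly_Mapping.lookup (g * Poly_Mapping.single m 1) a
      = (\<Sum>b. Poly_Mapping.lookup g b * (\<Sum>c. (1 when m = c) when b = a - c))"
    unfolding lookup_mult lookup_single by presburger
  also have "\<dots> = (\<Sum>b. Poly_Mapping.lookup g b when b = a - m)"
    proof (rule Sum_any.cong)
    fix b
    \<comment> \<open>Moving the condition \<open>c = m\<close> outermost lets the inner sum
      collapse to its single possible term.\<close>
    have "(\<Sum>c. (1 when m = c) when b = a - c) = (\<Sum>c. (1::'b) when b = a - m when c = m)"
      by (rule Sum_any.cong) (auto simp: when_def)
    then show "Poly_Mapping.lookup g b * (\<Sum>c. (1 when m = c) when b = a - c)
        = (Poly_Mapping.lookup g b when b = a - m)"
      by (simp add: mult_when)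
  qed
  finally show ?thesis
    by simp
qed

lemma laurent_eval_times_monomial:
  assumes "\<And>i. vec_nth \<xi> i \<noteq> 0"
  shows "laurent_eval (g * Poly_Mapping.single m 1) \<xi> = laurent_eval g \<xi> * monomial_value \<xi> m"
proof -
  have "laurent_eval (g * Poly_Mapping.single m 1) \<xi>
      = (\<Sum>a\<in>(\<lambda>a. a + m) ` Poly_Mapping.keys g.
           Poly_Mapping.lookup g (a - m) * monomial_value \<xi> a)"
    by (subst laurent_eval_superset[where A = "(\<lambda>a. a + m) ` Poly_Mapping.keys g"])
      (use keys_mult[of g "Poly_Mapping.single m 1"] in \<open>auto simp: lookup_times_monomial\<close>)
  also have "\<dots> = laurent_eval g \<xi> * monomial_value \<xi> m"
    by (simp add: sum.reindex laurent_eval_def sum_distrib_right monomial_value_add assms mult.assoc)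
  finally show ?thesis .
qed

lemma exponent_point_add: "exponent_point (a + b) = exponent_point a + exponent_point b"
  by (simp add: exponent_point_def Finite_Cartesian_Product.vec_eq_iff)

lemma exponent_point_sum: "exponent_point (\<Sum>i\<in>I. a i) = (\<Sum>i\<in>I. exponent_point (a i))"
  by (simp add: exponent_point_def Finite_Cartesian_Product.vec_eq_iff)

lemma exponent_point_in_newton_polytope:
  "a \<in> Poly_Mapping.keys g \<Longrightarrow> exponent_point a \<in> newton_polytope g"
  unfolding newton_polytope_def by (intro hull_inc imageI)

text \<open>The sum of all Newton polytopes is the \<open>i\<close>-th one plus the sum omitting it.
  Hence a coefficient vector over the lattice points of the full sum loses no term of a
  generator.\<close>

lemma keys_times_monomial_subset:
  assumes "i \<le> k" "m \<in> lattice_points (newton_sum_omit f k i)"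
  shows "Poly_Mapping.keys (f i * Poly_Mapping.single m 1) \<subseteq> lattice_points (newton_sum f k)"
proof
  fix a assume "a \<in> Poly_Mapping.keys (f i * Poly_Mapping.single m 1)"
  then obtain b where b: "b \<in> Poly_Mapping.keys (f i)" "a = b + m"
    using keys_mult[of "f i" "Poly_Mapping.single m 1"] by auto
  have "newton_sum f k = newton_polytope (f i) + newton_sum_omit f k i"
    unfolding newton_sum_def newton_sum_omit_def using assms(1) by (intro sum.remove) auto
  then show "a \<in> lattice_points (newton_sum f k)"
    using b assms(2) exponent_point_in_newton_polytope
    by (auto simp: lattice_points_def exponent_point_add)
qed

lemma lattice_points_newton_sum_omit_nonempty:
  assumes "newton_sum f k \<noteq> {}"
  shows "lattice_points (newton_sum_omit f k i) \<noteq> {}"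
proof -
  from assms obtain s where "\<And>j. j \<le> k \<Longrightarrow> s j \<in> newton_polytope (f j)"
    unfolding newton_sum_def by (auto simp: set_sum_alt)
  \<comment> \<open>The points \<open>s j\<close> may be non-integral, so they are exchanged for
    actual exponents, whose sum is a lattice point.\<close>
  then have "\<exists>a. a \<in> Poly_Mapping.keys (f j)" if "j \<le> k" for j
    using that unfolding newton_polytope_def by (metis convex_hull_empty empty_iff equals0I image_empty)
  then obtain a where "\<And>j. j \<le> k \<Longrightarrow> a j \<in> Poly_Mapping.keys (f j)"
    by metis
  then have "exponent_point (\<Sum>j\<in>{..k} - {i}. a j) \<in> newton_sum_omit f k i"
    unfolding newton_sum_omit_def exponent_point_sum
    by (auto simp: set_sum_alt intro!: exI[of _ "\<lambda>j. exponent_point (a j)"]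
        exponent_point_in_newton_polytope)
  then show ?thesis
    by (auto simp: lattice_points_def)
qed

text \<open>In row notation, \<open>right\<close> gives \<open>wB = -uD\<close>, so
  \<open>wBF = -uDF = uC\<close> by \<open>eq\<close>, and \<open>w(A + BF) = wA + uC = x\<close>.
  Everything is transposed because left eigenvectors are encoded as eigenvectors of the
  transpose.\<close>

lemma transpose_mult_vec_block_elimination:
  fixes A B C D F :: "'a::comm_ring_1 mat"
  assumes carrier: "A \<in> carrier_mat p p" "B \<in> carrier_mat p r" "C \<in> carrier_mat q p"
      "D \<in> carrier_mat q r" "F \<in> carrier_mat r p" "w \<in> carrier_vec p" "u \<in> carrier_vec q"
    and eq: "C + D * F = 0\<^sub>m q p"
    and left: "transpose_mat A *\<^sub>v w + transpose_mat C *\<^sub>v u = x"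
    and right: "transpose_mat B *\<^sub>v w + transpose_mat D *\<^sub>v u = 0\<^sub>v r"
  shows "transpose_mat (A + B * F) *\<^sub>v w = x"
proof -
  have At: "transpose_mat A \<in> carrier_mat p p" and Bt: "transpose_mat B \<in> carrier_mat r p"
    and Ct: "transpose_mat C \<in> carrier_mat p q" and Dt: "transpose_mat D \<in> carrier_mat r q"
    and Ft: "transpose_mat F \<in> carrier_mat p r"
    using carrier by auto
  have "transpose_mat F *\<^sub>v (transpose_mat B *\<^sub>v w + transpose_mat D *\<^sub>v u) = 0\<^sub>v p"
    unfolding right using Ft by auto
  then have F0: "transpose_mat F *\<^sub>v (transpose_mat B *\<^sub>v w)
      + transpose_mat F *\<^sub>v (transpose_mat D *\<^sub>v u) = 0\<^sub>v p"
    using mult_add_distrib_mat_vec[OF Ft, of "transpose_mat B *\<^sub>v w" "transpose_mat D *\<^sub>v u"]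
      Bt Dt carrier by simp
  have "transpose_mat (C + D * F) *\<^sub>v u = 0\<^sub>v p"
    unfolding eq using carrier by auto
  then have C0: "transpose_mat C *\<^sub>v u + transpose_mat F *\<^sub>v (transpose_mat D *\<^sub>v u) = 0\<^sub>v p"
    using carrier Ct Dt Ft
    by (simp add: transpose_add[of _ q p] transpose_mult[of _ q r] add_mult_distrib_mat_vec[of _ p q])
  have "transpose_mat (A + B * F) *\<^sub>v w
      = transpose_mat A *\<^sub>v w + transpose_mat F *\<^sub>v (transpose_mat B *\<^sub>v w)"
    using carrier At Bt Ft
    by (simp add: transpose_add[of _ p p] transpose_mult[of _ p r] add_mult_distrib_mat_vec[of _ p p])
  \<comment> \<open>By \<open>F0\<close> and \<open>C0\<close> both sides are the negative of the
    same vector, the transpose of \<open>D * F\<close> applied to \<open>u\<close>. The coordinates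
    are compared with the products kept folded.\<close>
  also have "transpose_mat F *\<^sub>v (transpose_mat B *\<^sub>v w) = transpose_mat C *\<^sub>v u"
  proof (rule eq_vecI)
    fix j assume "j < dim_vec (transpose_mat C *\<^sub>v u)"
    then have j: "j < p" using carrier by simp
    show "(transpose_mat F *\<^sub>v (transpose_mat B *\<^sub>v w)) $ j = (transpose_mat C *\<^sub>v u) $ j"
      using arg_cong[OF F0, of "\<lambda>v. v $ j"] arg_cong[OF C0, of "\<lambda>v. v $ j"] j carrier
      by (simp add: add_eq_0_iff2 del: index_mult_mat_vec)
  qed (use carrier in auto)
  finally show ?thesis
    using left by simp
qed

text \<open>A column lists the coefficients of one generator
  \<open>f i * Poly_Mapping.single m 1\<close>; weighting them by the values of the row monomials at
  \<xi> evaluates that generator.\<close>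

lemma coeff_matrix_left_mult_monomial_values:
  fixes f :: "nat \<Rightarrow> 'n::finite laurent" and bs :: "nat \<Rightarrow> (int ^ 'n) list" and k :: nat
  defines "cs \<equiv> concat (map (\<lambda>i. map (\<lambda>m. f i * Poly_Mapping.single m 1) (bs i)) [0..<Suc k])"
  assumes bs_set: "\<And>i. i \<le> k \<Longrightarrow> set (bs i) = lattice_points (newton_sum_omit f k i)"
    and es: "distinct es" "set es = lattice_points (newton_sum f k)"
    and j: "j < length cs"
  shows "(\<Sum>l<length es. coeff_matrix f k es bs $$ (l, j) * monomial_value \<xi> (es ! l))
    = laurent_eval (cs ! j) \<xi>"
proof -
  have "cs ! j \<in> set cs"
    using j by simp
  then obtain i m where im: "i \<le> k" "m \<in> set (bs i)" "cs ! j = f i * Poly_Mapping.single m 1"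
    unfolding cs_def by (auto simp: less_Suc_eq_le simp del: upt_Suc)
  have keys: "Poly_Mapping.keys (cs ! j) \<subseteq> set es"
    unfolding es im(3) using im(1,2) bs_set[of i] by (intro keys_times_monomial_subset) auto
  have "(\<Sum>l<length es. coeff_matrix f k es bs $$ (l, j) * monomial_value \<xi> (es ! l))
      = (\<Sum>l<length es. Poly_Mapping.lookup (cs ! j) (es ! l) * monomial_value \<xi> (es ! l))"
    unfolding coeff_matrix_def cs_def[symmetric] using j
    by (intro sum.cong) (simp_all add: mat_of_cols_index coeff_vec_def vec_of_list_index)
  also have "\<dots> = (\<Sum>m\<in>set es. Poly_Mapping.lookup (cs ! j) m * monomial_value \<xi> m)"
    \<comment> \<open>Distinctness of \<open>es\<close> makes each lattice point occur as exactly
      one row index.\<close>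
    using es(1) by (intro sum.reindex_bij_betw[where h = "(!) es"] bij_betw_nth) auto
  also have "\<dots> = laurent_eval (cs ! j) \<xi>"
    using keys by (simp add: laurent_eval_superset[where A = "set es"])
  finally show ?thesis .
qed

theorem theorem5:
  fixes f :: "nat \<Rightarrow> 'n::finite laurent"
    and k p q :: nat
    and bs :: "nat \<Rightarrow> (int ^ 'n) list"
    and es' :: "(int ^ 'n) list"
    and M11 M12 M21 M22 F :: "complex mat"
    and \<xi> :: "complex ^ 'n"
  assumes zero_mem: "0 \<in> newton_polytope (f 0)"
    and nonconst: "\<not> is_constant (f 0)"
    and full_dim: "aff_dim (newton_sum f k) = int CARD('n)"
    and unit_ideal: "ideal_generated (f ` {..k}) = UNIV"
    and bs_distinct: "\<And>i. i \<le> k \<Longrightarrow> distinct (bs i)"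
    and bs_set: "\<And>i. i \<le> k \<Longrightarrow> set (bs i) = lattice_points (newton_sum_omit f k i)"
    and es_distinct: "distinct (bs 0 @ es')"
    and es_set: "set (bs 0 @ es') = lattice_points (newton_sum f k)"
    and p_def: "p = length (bs 0)"
    and q_def: "q = length es'"
    and blocks: "split_block (coeff_matrix f k (bs 0 @ es') bs) p p = (M11, M12, M21, M22)"
    and F_dim: "F \<in> carrier_mat (\<Sum>i=1..k. length (bs i)) p"
    and F_eq: "M21 + M22 * F = 0\<^sub>m q p"
    and sol: "is_solution f k \<xi>"
  shows "left_eigenvector (M11 + M12 * F)
           (vec_of_list (map (monomial_value \<xi>) (bs 0))) (laurent_eval (f 0) \<xi>)"
proof -
  define es where "es = bs 0 @ es'"
  define M where "M = coeff_matrix f k es bs"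
  define r where "r = (\<Sum>i=1..k. length (bs i))"
  define cs0 where "cs0 = map (\<lambda>m. f 0 * Poly_Mapping.single m 1) (bs 0)"
  define cs1 where
    "cs1 = concat (map (\<lambda>i. map (\<lambda>m. f i * Poly_Mapping.single m 1) (bs i)) [1..<Suc k])"
  define w where "w = vec_of_list (map (monomial_value \<xi>) (bs 0))"
  define u where "u = vec_of_list (map (monomial_value \<xi>) es')"
  let ?row = "\<lambda>j. \<Sum>l<p + q. M $$ (l, j) * monomial_value \<xi> (es ! l)"
  have \<xi>: "\<And>i. vec_nth \<xi> i \<noteq> 0" and f_zero: "\<And>i. 1 \<le> i \<Longrightarrow> i \<le> k \<Longrightarrow> laurent_eval (f i) \<xi> = 0"
    using sol by (auto simp: is_solution_def)
  \<comment> \<open>Splitting off index 0 shows that the column blocks separate the multiples of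
    \<open>f 0\<close> from those of the equations of the system.\<close>
  have cs: "concat (map (\<lambda>i. map (\<lambda>m. f i * Poly_Mapping.single m 1) (bs i)) [0..<Suc k])
      = cs0 @ cs1"
    by (simp add: cs0_def cs1_def upt_rec[of 0] del: upt_Suc)
  have len: "length cs0 = p" "length cs1 = r" "length es = p + q"
    unfolding r_def cs0_def cs1_def es_def p_def q_def
    by (auto simp: length_concat comp_def interv_sum_list_conv_sum_set_nat atLeastLessThanSuc_atLeastAtMost
        simp del: upt_Suc)
  have dims: "dim_row M = p + q" "dim_col M = p + r"
    by (simp_all add: M_def coeff_matrix_def cs len del: upt_Suc)
  have blocks_M: "split_block M p p = (M11, M12, M21, M22)"
    using blocks unfolding M_def es_def .
  note block = split_block[OF blocks_M dims]
  have wu: "w \<in> carrier_vec p" "u \<in> carrier_vec q"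
    unfolding w_def u_def p_def q_def by (auto intro!: carrier_vecI)
  have row: "?row j = laurent_eval ((cs0 @ cs1) ! j) \<xi>" if "j < p + r" for j
  proof -
    have "j < length (cs0 @ cs1)"
      using that len by simp
    then show ?thesis
      unfolding M_def len(3)[symmetric] cs[symmetric]
      by (intro coeff_matrix_left_mult_monomial_values bs_set)
        (use es_distinct es_set in \<open>simp_all only: es_def\<close>)
  qed
  have sum_split: "sum h {..<p + n} = (\<Sum>l<p. h l) + (\<Sum>l<n. h (p + l))"
    for h :: "nat \<Rightarrow> complex" and n
    by (induction n) (simp_all add: add.assoc)
  have row_split: "?row j = (\<Sum>l<p. M $$ (l, j) * w $ l) + (\<Sum>l<q. M $$ (p + l, j) * u $ l)" for j
    unfolding sum_split
    by (intro arg_cong2[where f = "(+)"] sum.cong)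
      (simp_all add: es_def p_def q_def w_def u_def nth_append vec_of_list_index)
  have entries: "M11 = mat p p (\<lambda>(i, j). M $$ (i, j))" "M12 = mat p r (\<lambda>(i, j). M $$ (i, p + j))"
      "M21 = mat q p (\<lambda>(i, j). M $$ (p + i, j))" "M22 = mat q r (\<lambda>(i, j). M $$ (p + i, p + j))"
    using blocks_M by (auto simp: split_block_def Let_def dims add.commute)
  have left: "transpose_mat M11 *\<^sub>v w + transpose_mat M21 *\<^sub>v u = laurent_eval (f 0) \<xi> \<cdot>\<^sub>v w"
  proof (rule eq_vecI)
    fix j assume "j < dim_vec (laurent_eval (f 0) \<xi> \<cdot>\<^sub>v w)"
    then have j: "j < p"
      using wu by simp
    have "(transpose_mat M11 *\<^sub>v w + transpose_mat M21 *\<^sub>v u) $ j = ?row j"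
      using j wu unfolding row_split by (simp add: entries scalar_prod_def lessThan_atLeast0)
    \<comment> \<open>The list \<open>bs 0\<close> orders both the first \<open>p\<close> columns
      and the first \<open>p\<close> rows, so column \<open>j\<close> reproduces entry
      \<open>j\<close> of \<open>w\<close>, scaled by the value of \<open>f 0\<close>.\<close>
    also have "\<dots> = laurent_eval (f 0 * Poly_Mapping.single (bs 0 ! j) 1) \<xi>"
      using j by (simp add: row nth_append len) (simp add: cs0_def p_def)
    also have "\<dots> = (laurent_eval (f 0) \<xi> \<cdot>\<^sub>v w) $ j"
      using j by (simp add: laurent_eval_times_monomial[OF \<xi>] w_def p_def vec_of_list_index)
    finally show "(transpose_mat M11 *\<^sub>v w + transpose_mat M21 *\<^sub>v u) $ j
      = (laurent_eval (f 0) \<xi> \<cdot>\<^sub>v w) $ j" .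
  qed (use wu in \<open>simp add: entries\<close>)
  have right: "transpose_mat M12 *\<^sub>v w + transpose_mat M22 *\<^sub>v u = 0\<^sub>v r"
  proof (rule eq_vecI)
    fix j assume "j < dim_vec (0\<^sub>v r :: complex Matrix.vec)"
    then have j: "j < r"
      by simp
    have "(transpose_mat M12 *\<^sub>v w + transpose_mat M22 *\<^sub>v u) $ j = ?row (p + j)"
      using j wu unfolding row_split by (simp add: entries scalar_prod_def lessThan_atLeast0)
    also have "\<dots> = laurent_eval (cs1 ! j) \<xi>"
      using j by (simp add: row nth_append len)
    also have "\<dots> = 0"
    proof -
      \<comment> \<open>Every generator here is a monomial multiple of some \<open>f i\<close> with
        \<open>i\<close> at least 1, hence vanishes at \<xi>.\<close>
      have "cs1 ! j \<in> set cs1"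
        using j len by simp
      then obtain i m where "1 \<le> i" "i \<le> k" "cs1 ! j = f i * Poly_Mapping.single m 1"
        by (auto simp: cs1_def simp del: upt_Suc)
      then show ?thesis
        by (simp add: laurent_eval_times_monomial[OF \<xi>] f_zero)
    qed
    finally show "(transpose_mat M12 *\<^sub>v w + transpose_mat M22 *\<^sub>v u) $ j = 0\<^sub>v r $ j"
      using j by simp
  qed (simp add: entries)
  have "transpose_mat (M11 + M12 * F) *\<^sub>v w = laurent_eval (f 0) \<xi> \<cdot>\<^sub>v w"
    using transpose_mult_vec_block_elimination[OF block(1-4) F_dim[folded r_def] wu F_eq left right] .
  moreover have "w \<noteq> 0\<^sub>v p"
  proof -
    \<comment> \<open>The empty set has affine dimension -1, so full dimension excludes it. This
      makes \<open>bs 0\<close> nonempty, and entry 0 of \<open>w\<close>, a monomial value on the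
      torus, is nonzero.\<close>
    have "newton_sum f k \<noteq> {}"
      using full_dim by auto
    then have "bs 0 \<noteq> []"
      using lattice_points_newton_sum_omit_nonempty[of f k 0] bs_set[of 0] by auto
    then have "0 < p" and "w $ 0 \<noteq> 0"
      using monomial_value_nonzero[OF \<xi>] by (simp_all add: p_def w_def vec_of_list_index)
    then show ?thesis
      by auto
  qed
  ultimately show ?thesis
    using wu(1) block(1,2) F_dim
    unfolding w_def[symmetric] by (simp add: left_eigenvector_def eigenvector_def)
qed

end
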